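(* Consider the scalar system $X_{k+1}=aX_k+bU_k+W_k$ with observations $Y_k=D_{k-\tau}X_{k-\tau}$ and fixed delay $\tau\ge1$, under the optimal controller $U_k=-L\,\mathbb{E}[X_k\mid I^{\mathcal C}_k]$. Under symmetric scheduling policies, for all $m\ge\tau$, $$U_{t_k+m}=-L\,\mathbb{E}[X_{t_k+m}\mid I^{\mathcal C}_{t_k+m}]=-L\,(a-bL)^{m-\tau}\Big(a^{\tau}X_{t_k}+\sum_{j=0}^{\tau-1}a^{\tau-1-j}\,b\,U_{t_k+j}\Big).$$
   Context: $X_k$ is the real-valued state, $U_k$ the control input, $a,b\in\mathbb{R}$; the disturbances $\{W_k\}$ are i.i.d., zero-mean, with finite variance $\sigma_W^2$ and symmetrically distributed about zero. $D_k\in\{0,1\}$ is the scheduling decision. Controller information: $I^{\mathcal C}_k=\{Y_0,U_0,\dots,Y_{k-1},U_{k-1},Y_k\}$. Scheduler information: $I^{\mathcal S}_k=\{X_0,D_0,U_0,\dots,X_{k-1},D_{k-1},U_{k-1},X_k\}$. Scheduling policies are $D_k=f_k(I^{\mathcal S}_k)$, with admissible set $\Pi$ (usual measurability and integrability conditions). $L=\frac{abP}{r+b^2P}$ with $P=a^2P+q-\frac{(abP)^2}{r+b^2P}$, $q,r>0$. $t_k=\max\{j\le k:D_j=1\}$ is the most recent update time; times $t_k+m$ are understood as times for which $t_k$ is the most recent update relevant to the controller. $S_m=\sum_{j=0}^{m-1}a^{m-1-j}W_{t_k+j}$. A scheduling policy $\pi\in\Pi$ is symmetric if $\mathbb{E}[S_m\mid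 I^{\mathcal C}_{t_k+m}]=0$ for all $k,m\in\mathbb{N}$.
   Formalization: The formula is claimed almost surely where the controller, given its information at time t_k+τ, is certain that D_{t_k}=1; this is automatic if X_{t_k}≠0. Otherwise a transmitted zero state looks like no transmission and the formula can fail. *)

theory Defs
  imports "HOL-Probability.Probability"
begin

type_synonym 'w process = "nat \<Rightarrow> 'w \<Rightarrow> real"
type_synonym 'w decisions = "nat \<Rightarrow> 'w \<Rightarrow> nat"

text \<open>Before the first sample can arrive (\<open>k < \<tau>\<close>) the controller observes \<open>0\<close>.\<close>

definition observation :: "nat \<Rightarrow> 'w process \<Rightarrow> 'w decisions \<Rightarrow> 'w process" where
  "observation \<tau> X D k \<omega> = (if k < \<tau> then 0 else real (D (k - \<tau>) \<omega>) * X (k - \<tau>) \<omega>)"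

definition ctrl_history ::
    "nat \<Rightarrow> 'w process \<Rightarrow> 'w decisions \<Rightarrow> 'w process \<Rightarrow> nat \<Rightarrow> 'w \<Rightarrow> (nat \<Rightarrow> real) \<times> (nat \<Rightarrow> real)" where
  "ctrl_history \<tau> X D U k \<omega> =
     (\<lambda>i\<in>{..k}. observation \<tau> X D i \<omega>, \<lambda>i\<in>{..<k}. U i \<omega>)"

text \<open>Conditioning on \<open>I\<^sup>C\<^sub>k\<close> means conditioning on the sigma-algebra it generates.\<close>

definition ctrl_info ::
    "'w measure \<Rightarrow> nat \<Rightarrow> 'w process \<Rightarrow> 'w decisions \<Rightarrow> 'w process \<Rightarrow> nat \<Rightarrow> 'w measure" where
  "ctrl_info M \<tau> X D U k =
     vimage_algebra (space M) (ctrl_history \<tau> X D U k)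
       ((\<Pi>\<^sub>M i\<in>{..k}. borel) \<Otimes>\<^sub>M (\<Pi>\<^sub>M i\<in>{..<k}. borel))"

type_synonym sched_hist = "(nat \<Rightarrow> real) \<times> (nat \<Rightarrow> nat) \<times> (nat \<Rightarrow> real)"

definition sched_history ::
    "'w process \<Rightarrow> 'w decisions \<Rightarrow> 'w process \<Rightarrow> nat \<Rightarrow> 'w \<Rightarrow> sched_hist" where
  "sched_history X D U k \<omega> =
     (\<lambda>i\<in>{..k}. X i \<omega>, \<lambda>i\<in>{..<k}. D i \<omega>, \<lambda>i\<in>{..<k}. U i \<omega>)"

definition sched_space :: "nat \<Rightarrow> sched_hist measure" where
  "sched_space k =
     (\<Pi>\<^sub>M i\<in>{..k}. borel) \<Otimes>\<^sub>M ((\<Pi>\<^sub>M i\<in>{..<k}. count_space {0, 1}) \<Otimes>\<^sub>M (\<Pi>\<^sub>M i\<in>{..<k}. borel))"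

definition admissible_policies :: "(nat \<Rightarrow> sched_hist \<Rightarrow> nat) set" where
  "admissible_policies = {f. \<forall>k. f k \<in> sched_space k \<rightarrow>\<^sub>M count_space {0, 1}}"

definition disturbance :: "'w measure \<Rightarrow> 'w process \<Rightarrow> real \<Rightarrow> bool" where
  "disturbance M W \<sigma>\<^sub>W \<longleftrightarrow>
     prob_space.indep_vars M (\<lambda>_. borel) W UNIV \<and>
     (\<forall>k. distr M borel (W k) = distr M borel (W 0)) \<and>
     (\<forall>k. integrable M (W k) \<and> (\<integral>\<omega>. W k \<omega> \<partial>M) = 0) \<and>
     (\<forall>k. integrable M (\<lambda>\<omega>. (W k \<omega>)\<^sup>2) \<and> (\<integral>\<omega>. (W k \<omega>)\<^sup>2 \<partial>M) = \<sigma>\<^sub>W\<^sup>2) \<and>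
     (\<forall>k. distr M borel (\<lambda>\<omega>. - W k \<omega>) = distr M borel (W k))"

text \<open>Meaningful only if some \<open>D j \<omega> = 1\<close> with \<open>j \<le> k\<close>.\<close>

definition last_update :: "'w decisions \<Rightarrow> nat \<Rightarrow> 'w \<Rightarrow> nat" where
  "last_update D k \<omega> = Max {j. j \<le> k \<and> D j \<omega> = 1}"

text \<open>
  \<open>t = t\<^sub>k(\<omega>)\<close> is the most recent update relevant to the controller at time \<open>t + m\<close>:
  no later update has reached the controller by then, and the controller is aware of the update at
  \<open>t\<close> once it arrives, that is, \<open>P(D\<^sub>t = 1 | I\<^sup>C\<^sub>t\<^sub>+\<^sub>\<tau>) = 1\<close>. The latter is automatic
  unless \<open>X\<^sub>t = 0\<close> (lemma \<open>nonzero_update_known\<close> below): an observation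
  \<open>D\<^sub>t X\<^sub>t = 0\<close> by itself does not tell whether an update was sent.
\<close>

definition relevant_update ::
    "'w measure \<Rightarrow> nat \<Rightarrow> 'w process \<Rightarrow> 'w decisions \<Rightarrow> 'w process \<Rightarrow> nat \<Rightarrow> nat \<Rightarrow> 'w \<Rightarrow> bool" where
  "relevant_update M \<tau> X D U k m \<omega> \<longleftrightarrow>
     (\<exists>j\<le>k. D j \<omega> = 1) \<and>
     (let t = last_update D k \<omega> in
        (\<forall>j. t < j \<and> j + \<tau> \<le> t + m \<longrightarrow> D j \<omega> = 0) \<and>
        real_cond_exp M (ctrl_info M \<tau> X D U (t + \<tau>)) (indicator {\<omega>'. D t \<omega>' = 1}) \<omega> = 1)"

definition accumulated_noise :: "real \<Rightarrow> 'w process \<Rightarrow> nat \<Rightarrow> nat \<Rightarrow> 'w \<Rightarrow> real" where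
  "accumulated_noise a W t m \<omega> = (\<Sum>j<m. a ^ (m - 1 - j) * W (t + j) \<omega>)"

text \<open>
  A conditional expectation at the random time \<open>t\<^sub>k + m\<close> is the process
  \<open>n \<mapsto> E[\<sqdot> | I\<^sup>C\<^sub>n]\<close> evaluated at \<open>n = t\<^sub>k(\<omega>) + m\<close>; inside it \<open>t\<close> is a
  fixed time.
\<close>

definition symmetric_scheduling ::
    "'w measure \<Rightarrow> real \<Rightarrow> nat \<Rightarrow> 'w process \<Rightarrow> 'w process \<Rightarrow> 'w decisions \<Rightarrow> 'w process \<Rightarrow> bool" where
  "symmetric_scheduling M a \<tau> W X D U \<longleftrightarrow>
     (\<forall>k m. AE \<omega> in M. relevant_update M \<tau> X D U k m \<omega> \<longrightarrow>
        (let t = last_update D k \<omega> in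
           real_cond_exp M (ctrl_info M \<tau> X D U (t + m)) (accumulated_noise a W t m) \<omega> = 0))"

lemma nonzero_update_known:
  assumes "prob_space M"
    and X: "\<And>k. X k \<in> borel_measurable M"
    and U: "\<And>k. U k \<in> borel_measurable M"
    and D: "\<And>k. D k \<in> M \<rightarrow>\<^sub>M count_space {0, 1}"
  shows "AE \<omega> in M. D t \<omega> = 1 \<and> X t \<omega> \<noteq> 0 \<longrightarrow>
    real_cond_exp M (ctrl_info M \<tau> X D U (t + \<tau>)) (indicator {\<omega>'. D t \<omega>' = 1}) \<omega> = 1"
proof -
  interpret prob_space M by fact
  let ?N = "(\<Pi>\<^sub>M i\<in>{..t + \<tau>}. borel :: real measure) \<Otimes>\<^sub>M (\<Pi>\<^sub>M i\<in>{..<t + \<tau>}. borel :: real measure)"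
  let ?h = "ctrl_history \<tau> X D U (t + \<tau>)"
  define F where "F = ctrl_info M \<tau> X D U (t + \<tau>)"
  define Y where "Y = observation \<tau> X D (t + \<tau>)"
  have D': "(\<lambda>\<omega>. real (D k \<omega>)) \<in> borel_measurable M" for k
    using measurable_compose[OF D, of "real" borel] by simp
  have obs: "observation \<tau> X D i \<in> borel_measurable M" for i
    unfolding observation_def[abs_def] using X D' by (cases "i < \<tau>") auto
  have h: "?h \<in> M \<rightarrow>\<^sub>M ?N"
    unfolding ctrl_history_def[abs_def] using obs U
    by (intro measurable_Pair measurable_restrict) auto
  have hF: "?h \<in> F \<rightarrow>\<^sub>M ?N"
    unfolding F_def ctrl_info_def
    by (rule measurable_vimage_algebra1) (use measurable_space[OF h] in auto)
  have sub: "subalgebra M F"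
    unfolding subalgebra_def F_def ctrl_info_def
    by (auto simp: sets_vimage_algebra2 measurable_space[OF h] intro: measurable_sets[OF h])
  interpret finite_measure_subalgebra M F
    using sub by unfold_locales
  have "Y = (\<lambda>\<omega>. fst (?h \<omega>) (t + \<tau>))"
    by (auto simp: Y_def ctrl_history_def)
  moreover have "(\<lambda>\<omega>. fst (?h \<omega>) (t + \<tau>)) \<in> borel_measurable F"
    by (rule measurable_compose[OF measurable_compose[OF hF measurable_fst]]) simp
  ultimately have Y: "Y \<in> borel_measurable F" by simp
  define c :: "'a \<Rightarrow> real" where "c \<omega> = (if Y \<omega> \<noteq> 0 then 1 else 0)" for \<omega>
  let ?d = "indicator {\<omega>. D t \<omega> = 1} :: 'a \<Rightarrow> real"
  have c: "c \<in> borel_measurable F" unfolding c_def[abs_def] using Y by measurable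
  have "(\<lambda>\<omega>. if real (D t \<omega>) = 1 then 1 else 0 :: real) \<in> borel_measurable M"
    using D'[of t] by measurable
  moreover have "?d = (\<lambda>\<omega>. if real (D t \<omega>) = 1 then 1 else 0)" by (auto simp: indicator_def)
  ultimately have d: "?d \<in> borel_measurable M" by simp
  have cM: "c \<in> borel_measurable M" using measurable_from_subalg[OF sub c] .
  have cd: "c \<omega> * ?d \<omega> = c \<omega>" if "\<omega> \<in> space M" for \<omega>
    using measurable_space[OF D[of t] that]
    by (auto simp: c_def Y_def observation_def indicator_def)
  have ic: "integrable M c"
    by (rule integrable_const_bound[of _ 1]) (auto simp: cM, simp add: c_def)
  have "integrable M (\<lambda>\<omega>. c \<omega> * ?d \<omega>)"
    by (subst Bochner_Integration.integrable_cong[OF refl cd]) (auto simp: ic)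
  then have "AE \<omega> in M. real_cond_exp M F (\<lambda>\<omega>. c \<omega> * ?d \<omega>) \<omega> = c \<omega> * real_cond_exp M F ?d \<omega>"
    by (intro real_cond_exp_mult c d)
  moreover have "AE \<omega> in M. real_cond_exp M F (\<lambda>\<omega>. c \<omega> * ?d \<omega>) \<omega> = real_cond_exp M F c \<omega>"
    by (rule real_cond_exp_cong) (use cd cM d in auto)
  moreover have "AE \<omega> in M. real_cond_exp M F c \<omega> = c \<omega>"
    by (rule real_cond_exp_F_meas[OF ic c])
  ultimately show ?thesis
    unfolding F_def[symmetric]
    by eventually_elim (auto simp: c_def Y_def observation_def)
qed

end

theory Submission
  imports Defs
begin

text \<open>
  Unrolling the dynamics for \<open>m\<close> steps gives
  \<open>X\<^sub>t\<^sub>+\<^sub>m = a\<^sup>m X\<^sub>t + \<Sum>\<^sub>j a\<^sup>m\<^sup>-\<^sup>1\<^sup>-\<^sup>j b U\<^sub>t\<^sub>+\<^sub>j + S\<^sub>m\<close>, and the conditional expectation given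
  \<open>I\<^sup>C\<^sub>t\<^sub>+\<^sub>m\<close> can be taken term by term. The inputs are part of the information. The noise term
  vanishes by symmetry of the scheduling policy. The first term is \<open>a\<^sup>m X\<^sub>t\<close> itself: the controller
  sees \<open>D\<^sub>t X\<^sub>t\<close>, and where it is certain that \<open>D\<^sub>t = 1\<close> this is \<open>X\<^sub>t\<close> (lemma
  \<open>known_update_estimate\<close>). Hence the estimate at \<open>t + m\<close> is the noise-free prediction
  \<open>e\<^sub>m = a\<^sup>m X\<^sub>t + \<Sum>\<^sub>j a\<^sup>m\<^sup>-\<^sup>1\<^sup>-\<^sup>j b U\<^sub>t\<^sub>+\<^sub>j\<close>.

  An update relevant at \<open>t + m\<close> is also relevant at each \<open>t + i\<close> with
  \<open>\<tau> \<le> i \<le> m\<close>, so there the controller applies \<open>U\<^sub>t\<^sub>+\<^sub>i = - L e\<^sub>i\<close>. The recursion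
  \<open>e\<^sub>i\<^sub>+\<^sub>1 = a e\<^sub>i + b U\<^sub>t\<^sub>+\<^sub>i = (a - b L) e\<^sub>i\<close>, started at \<open>i = \<tau>\<close>, gives the
  formula. The random time \<open>t\<^sub>k\<close> has countably many values, so everything may be proved for a
  fixed \<open>t\<close> up to a null set.
\<close>

section \<open>Conditional expectations on events of the conditioning algebra\<close>

text \<open>
  The event \<open>B\<close> where the conditional probability of \<open>E\<close> is \<open>1\<close> is itself an event of the
  conditioning algebra, so \<open>P(B - E)\<close> is the integral over \<open>B\<close> of one minus that
  conditional probability, which vanishes there.
\<close>

lemma (in finite_measure) almost_surely_if_cond_prob_1:
  assumes sub: "subalgebra M F"
    and E: "(indicator E :: 'a \<Rightarrow> real) \<in> borel_measurable M"
  shows "AE \<omega> in M. real_cond_exp M F (indicator E) \<omega> = 1 \<longrightarrow> \<omega> \<in> E"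
proof -
  interpret finite_measure_subalgebra M F
    using sub by unfold_locales
  let ?p = "real_cond_exp M F (indicator E)"
  define B where "B = {\<omega> \<in> space F. ?p \<omega> = 1}"
  have B: "B \<in> sets F"
    unfolding B_def by measurable
  have BM: "B \<in> sets M"
    using B sub by (auto simp: subalgebra_def)
  have iE: "integrable M (indicator E :: 'a \<Rightarrow> real)"
    by (rule integrable_const_bound[of _ 1]) (auto simp: E indicator_def)
  have iB: "integrable M (indicator B :: 'a \<Rightarrow> real)"
    using BM by (rule integrable_real_indicator) (simp add: less_top[symmetric])
  have iBE: "integrable M (\<lambda>\<omega>. indicator B \<omega> * indicator E \<omega> :: real)"
    using integrable_mult_indicator[OF BM iE] by simp
  have "(\<integral>\<omega>. indicator B \<omega> * indicator E \<omega> \<partial>M) = (\<integral>\<omega>. indicator B \<omega> * ?p \<omega> \<partial>M)"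
    using real_cond_exp_intA[OF iE B] by (simp add: set_lebesgue_integral_def)
  also have "\<dots> = (\<integral>\<omega>. indicator B \<omega> \<partial>M)"
    by (rule Bochner_Integration.integral_cong) (auto simp: B_def indicator_def)
  finally have "(\<integral>\<omega>. indicator B \<omega> - indicator B \<omega> * indicator E \<omega> \<partial>M) = (0::real)"
    using iB iBE by simp
  moreover have "integrable M (\<lambda>\<omega>. indicator B \<omega> - indicator B \<omega> * indicator E \<omega> :: real)"
    using iB iBE by simp
  ultimately have "AE \<omega> in M. indicator B \<omega> - indicator B \<omega> * indicator E \<omega> = (0::real)"
    by (subst (asm) integral_nonneg_eq_0_iff_AE) (auto simp: indicator_def)
  moreover have "AE \<omega> in M. \<omega> \<in> space F"
    using sub by (auto simp: subalgebra_def)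
  ultimately show ?thesis
    by eventually_elim (auto simp: B_def indicator_def split: if_splits)
qed

lemma (in sigma_finite_subalgebra) real_cond_exp_eq_on:
  assumes f: "integrable M f"
    and g: "g \<in> borel_measurable F"
    and B: "B \<in> sets F"
    and eq: "AE \<omega> in M. \<omega> \<in> B \<longrightarrow> f \<omega> = g \<omega>"
  shows "AE \<omega> in M. \<omega> \<in> B \<longrightarrow> real_cond_exp M F f \<omega> = g \<omega>"
proof -
  have BM: "B \<in> sets M"
    using B subalg by (auto simp: subalgebra_def)
  have iB: "(indicator B :: 'a \<Rightarrow> real) \<in> borel_measurable F"
    using B by simp
  have gM: "g \<in> borel_measurable M"
    using measurable_from_subalg[OF subalg g] .
  have eq': "AE \<omega> in M. indicator B \<omega> * f \<omega> = indicator B \<omega> * g \<omega>"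
    using eq by eventually_elim (auto simp: indicator_def)
  have Bf: "integrable M (\<lambda>\<omega>. indicator B \<omega> * f \<omega>)"
    using integrable_mult_indicator[OF BM f] by simp
  have Bg: "integrable M (\<lambda>\<omega>. indicator B \<omega> * g \<omega>)"
    using BM gM by (intro integrable_cong_AE_imp[OF Bf _]) (use eq' in auto)
  have "AE \<omega> in M. real_cond_exp M F (\<lambda>\<omega>. indicator B \<omega> * f \<omega>) \<omega>
      = indicator B \<omega> * real_cond_exp M F f \<omega>"
    using iB Bf f by (intro real_cond_exp_mult) auto
  moreover have "AE \<omega> in M. real_cond_exp M F (\<lambda>\<omega>. indicator B \<omega> * f \<omega>) \<omega>
      = real_cond_exp M F (\<lambda>\<omega>. indicator B \<omega> * g \<omega>) \<omega>"
    using Bf Bg eq' by (intro real_cond_exp_cong) auto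
  moreover have "AE \<omega> in M. real_cond_exp M F (\<lambda>\<omega>. indicator B \<omega> * g \<omega>) \<omega>
      = indicator B \<omega> * g \<omega>"
    using iB g by (intro real_cond_exp_F_meas Bg) auto
  ultimately show ?thesis
    by eventually_elim (auto simp: indicator_def split: if_splits)
qed

section \<open>The information of the controller\<close>

lemma ctrl_history_in_space:
  "ctrl_history \<tau> X D U k \<omega>
    \<in> space ((\<Pi>\<^sub>M i\<in>{..k}. (borel :: real measure)) \<Otimes>\<^sub>M (\<Pi>\<^sub>M i\<in>{..<k}. (borel :: real measure)))"
  by (auto simp: ctrl_history_def space_pair_measure space_PiM)

lemma space_ctrl_info [simp]: "space (ctrl_info M \<tau> X D U k) = space M"
  by (simp add: ctrl_info_def)

lemma measurable_ctrl_history: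
  "ctrl_history \<tau> X D U k \<in> ctrl_info M \<tau> X D U k
    \<rightarrow>\<^sub>M (\<Pi>\<^sub>M i\<in>{..k}. borel) \<Otimes>\<^sub>M (\<Pi>\<^sub>M i\<in>{..<k}. borel)"
  unfolding ctrl_info_def
  by (rule measurable_vimage_algebra1) (use ctrl_history_in_space in auto)

lemma observation_measurable_ctrl_info:
  assumes "i \<le> k"
  shows "observation \<tau> X D i \<in> borel_measurable (ctrl_info M \<tau> X D U k)"
proof -
  have "(\<lambda>\<omega>. fst (ctrl_history \<tau> X D U k \<omega>) i) \<in> borel_measurable (ctrl_info M \<tau> X D U k)"
    using assms
    by (intro measurable_compose[OF measurable_compose[OF measurable_ctrl_history measurable_fst]]) simp
  then show ?thesis
    using assms by (simp add: ctrl_history_def)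
qed

lemma input_measurable_ctrl_info:
  assumes "i < k"
  shows "U i \<in> borel_measurable (ctrl_info M \<tau> X D U k)"
proof -
  have "(\<lambda>\<omega>. snd (ctrl_history \<tau> X D U k \<omega>) i) \<in> borel_measurable (ctrl_info M \<tau> X D U k)"
    using assms
    by (intro measurable_compose[OF measurable_compose[OF measurable_ctrl_history measurable_snd]]) simp
  then show ?thesis
    using assms by (simp add: ctrl_history_def)
qed

text \<open>
  A sigma-algebra that makes the observations and inputs of the history measurable contains the
  information; this serves both to compare with the ambient space and to compare two times.
\<close>

lemma subalgebra_ctrl_infoI:
  assumes "space N = space M"
    and obs: "\<And>i. i \<le> k \<Longrightarrow> observation \<tau> X D i \<in> borel_measurable N"
    and inp: "\<And>i. i < k \<Longrightarrow> U i \<in> borel_measurable N"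
  shows "subalgebra N (ctrl_info M \<tau> X D U k)"
proof -
  have "ctrl_history \<tau> X D U k \<in> N \<rightarrow>\<^sub>M (\<Pi>\<^sub>M i\<in>{..k}. borel) \<Otimes>\<^sub>M (\<Pi>\<^sub>M i\<in>{..<k}. borel)"
    unfolding ctrl_history_def[abs_def] using obs inp
    by (intro measurable_Pair measurable_restrict) auto
  moreover have "ctrl_history \<tau> X D U k \<in> space M
      \<rightarrow> space ((\<Pi>\<^sub>M i\<in>{..k}. borel) \<Otimes>\<^sub>M (\<Pi>\<^sub>M i\<in>{..<k}. borel))"
    using ctrl_history_in_space by auto
  ultimately show ?thesis
    using assms(1)
    by (auto simp: subalgebra_def ctrl_info_def sets_vimage_algebra2 dest: measurable_sets)
qed

lemma subalgebra_ctrl_info: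
  assumes X: "\<And>k. X k \<in> borel_measurable M"
    and U: "\<And>k. U k \<in> borel_measurable M"
    and D: "\<And>k. D k \<in> M \<rightarrow>\<^sub>M count_space {0, 1}"
  shows "subalgebra M (ctrl_info M \<tau> X D U k)"
proof (rule subalgebra_ctrl_infoI)
  have [measurable]: "(\<lambda>\<omega>. real (D i \<omega>)) \<in> borel_measurable M" for i
    by (rule measurable_compose[OF D]) simp
  show "observation \<tau> X D i \<in> borel_measurable M" for i
    unfolding observation_def[abs_def] using X by (cases "i < \<tau>") auto
qed (use U in auto)

lemma subalgebra_ctrl_info_mono:
  assumes "k \<le> l"
  shows "subalgebra (ctrl_info M \<tau> X D U l) (ctrl_info M \<tau> X D U k)"
  using assms
  by (intro subalgebra_ctrl_infoI observation_measurable_ctrl_info input_measurable_ctrl_info) auto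

text \<open>
  The observation \<open>D\<^sub>t X\<^sub>t\<close> agrees with \<open>X\<^sub>t\<close> almost everywhere on the event that
  \<open>D\<^sub>t = 1\<close> is certain at time \<open>t + \<tau>\<close>, and this event is still known to the controller at any
  later time \<open>n\<close>.
\<close>

lemma (in prob_space) known_update_estimate:
  assumes X: "\<And>k. X k \<in> borel_measurable M"
    and U: "\<And>k. U k \<in> borel_measurable M"
    and D: "\<And>k. D k \<in> M \<rightarrow>\<^sub>M count_space {0, 1}"
    and int: "integrable M (X t)"
    and n: "t + \<tau> \<le> n"
  shows "AE \<omega> in M.
    real_cond_exp M (ctrl_info M \<tau> X D U (t + \<tau>)) (indicator {\<omega>'. D t \<omega>' = 1}) \<omega> = 1 \<longrightarrow>
    real_cond_exp M (ctrl_info M \<tau> X D U n) (X t) \<omega> = X t \<omega>"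
proof -
  let ?G = "ctrl_info M \<tau> X D U (t + \<tau>)" and ?F = "ctrl_info M \<tau> X D U n"
  let ?p = "real_cond_exp M ?G (indicator {\<omega>'. D t \<omega>' = 1})"
  let ?Y = "observation \<tau> X D (t + \<tau>)"
  define B where "B = {\<omega> \<in> space ?G. ?p \<omega> = 1}"
  have subM: "subalgebra M (ctrl_info M \<tau> X D U k)" for k
    by (rule subalgebra_ctrl_info[OF X U D])
  interpret finite_measure_subalgebra M ?F
    using subM by unfold_locales
  have "(\<lambda>\<omega>. indicator {1} (D t \<omega>) :: real) \<in> borel_measurable M"
    by (rule measurable_compose[OF D]) simp
  also have "(\<lambda>\<omega>. indicator {1} (D t \<omega>) :: real) = indicator {\<omega>'. D t \<omega>' = 1}"
    by (auto simp: indicator_def)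
  finally have known: "AE \<omega> in M. ?p \<omega> = 1 \<longrightarrow> D t \<omega> = 1"
    using almost_surely_if_cond_prob_1[OF subM, where E = "{\<omega>'. D t \<omega>' = 1}"] by simp
  have "B \<in> sets ?G"
    unfolding B_def by measurable
  then have B: "B \<in> sets ?F"
    using subalgebra_ctrl_info_mono[OF n, of M \<tau> X D U] by (auto simp: subalgebra_def)
  have "AE \<omega> in M. \<omega> \<in> B \<longrightarrow> X t \<omega> = ?Y \<omega>"
    using known by eventually_elim (auto simp: B_def observation_def)
  from real_cond_exp_eq_on[OF int observation_measurable_ctrl_info[OF n] B this]
  show ?thesis
    using known AE_space by eventually_elim (auto simp: B_def observation_def)
qed

section \<open>The closed loop\<close>

lemma sum_power_weighted_Suc:
  fixes a :: "'a::comm_semiring_1"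
  shows "(\<Sum>j<Suc m. a ^ (Suc m - 1 - j) * c j) = a * (\<Sum>j<m. a ^ (m - 1 - j) * c j) + c m"
proof -
  have "a ^ (m - j) * c j = a * (a ^ (m - 1 - j) * c j)" if "j < m" for j
  proof -
    have "m - j = Suc (m - 1 - j)"
      using that by simp
    then show ?thesis
      by (simp only: power_Suc mult.assoc)
  qed
  then have "(\<Sum>j<m. a ^ (m - j) * c j) = a * (\<Sum>j<m. a ^ (m - 1 - j) * c j)"
    unfolding sum_distrib_left by (intro sum.cong refl) auto
  then show ?thesis
    by simp
qed

lemma state_unrolled:
  assumes "\<And>k. X (Suc k) \<omega> = a * X k \<omega> + b * U k \<omega> + W k \<omega>"
  shows "X (t + m) \<omega> = a ^ m * X t \<omega> + (\<Sum>j<m. a ^ (m - 1 - j) * b * U (t + j) \<omega>)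
    + accumulated_noise a W t m \<omega>"
proof (induction m)
  case (Suc m)
  then show ?case
    using assms[of "t + m"] sum_power_weighted_Suc[where c = "\<lambda>j. b * U (t + j) \<omega>"]
      sum_power_weighted_Suc[where c = "\<lambda>j. W (t + j) \<omega>"]
    by (simp only: accumulated_noise_def mult.assoc add_Suc_right power_Suc distrib_left add.assoc
      add.left_commute add.commute)
qed (simp add: accumulated_noise_def)

lemma prediction_closed_loop:
  fixes a b L x :: real and u :: "nat \<Rightarrow> real"
  defines "e \<equiv> \<lambda>m. a ^ m * x + (\<Sum>j<m. a ^ (m - 1 - j) * b * u j)"
  assumes "\<tau> \<le> m"
    and fb: "\<And>i. \<tau> \<le> i \<Longrightarrow> i < m \<Longrightarrow> u i = - L * e i"
  shows "e m = (a - b * L) ^ (m - \<tau>) * e \<tau>"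
proof -
  have e_Suc: "e (Suc i) = a * e i + b * u i" for i
    using sum_power_weighted_Suc[where c = "\<lambda>j. b * u j"]
    by (simp only: e_def mult.assoc power_Suc distrib_left add.assoc)
  have "i \<le> m \<longrightarrow> e i = (a - b * L) ^ (i - \<tau>) * e \<tau>" if "\<tau> \<le> i" for i
    using that
  proof (induction rule: dec_induct)
    case (step i)
    show ?case
    proof
      assume i: "Suc i \<le> m"
      have "e (Suc i) = (a - b * L) * e i"
        using e_Suc[of i] fb[of i] step.hyps i by (simp add: algebra_simps)
      then show "e (Suc i) = (a - b * L) ^ (Suc i - \<tau>) * e \<tau>"
        using step i by (simp add: Suc_diff_le)
    qed
  qed simp
  then show ?thesis
    using \<open>\<tau> \<le> m\<close> by blast
qed

lemma relevant_update_earlier: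
  assumes "relevant_update M \<tau> X D U k m \<omega>" and "i \<le> m"
  shows "relevant_update M \<tau> X D U k i \<omega>"
proof -
  have "j + \<tau> \<le> t + m" if "j + \<tau> \<le> t + i" for j t
    using that assms(2) by simp
  then show ?thesis
    using assms(1) unfolding relevant_update_def Let_def by blast
qed

lemma measurable_scheduler:
  assumes X: "\<And>k. X k \<in> borel_measurable M"
    and U: "\<And>k. U k \<in> borel_measurable M"
    and f: "f \<in> admissible_policies"
    and D: "\<And>k \<omega>. \<omega> \<in> space M \<Longrightarrow> D k \<omega> = f k (sched_history X D U k \<omega>)"
  shows "D k \<in> M \<rightarrow>\<^sub>M count_space {0, 1}"
proof (induction k rule: less_induct)
  case (less k)
  have "sched_history X D U k \<in> M \<rightarrow>\<^sub>M sched_space k"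
    unfolding sched_history_def[abs_def] sched_space_def using X U less
    by (intro measurable_Pair measurable_restrict) auto
  then have "(\<lambda>\<omega>. f k (sched_history X D U k \<omega>)) \<in> M \<rightarrow>\<^sub>M count_space {0, 1}"
    by (rule measurable_compose) (use f in \<open>auto simp: admissible_policies_def\<close>)
  then show ?case
    by (subst measurable_cong[OF D])
qed

text \<open>
  Integrability passes around the loop: the input is a multiple of a conditional expectation of the
  current state, and the next state is a combination of state, input and disturbance.
\<close>

lemma (in prob_space) closed_loop_integrable:
  assumes sub: "\<And>k. subalgebra M (F k)"
    and X0: "integrable M (X 0)"
    and W: "\<And>k. integrable M (W k)"
    and dyn: "\<And>k \<omega>. \<omega> \<in> space M \<Longrightarrow> X (Suc k) \<omega> = a * X k \<omega> + b * U k \<omega> + W k \<omega>"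
    and U: "\<And>k. U k \<in> borel_measurable M"
    and ctrl: "\<And>k. AE \<omega> in M. U k \<omega> = - L * real_cond_exp M (F k) (X k) \<omega>"
  shows "integrable M (X k)" and "integrable M (U k)"
proof -
  have input: "integrable M (U k)" if "integrable M (X k)" for k
  proof -
    interpret finite_measure_subalgebra M "F k"
      using sub by unfold_locales
    have "integrable M (\<lambda>\<omega>. - L * real_cond_exp M (F k) (X k) \<omega>)"
      using real_cond_exp_int(1)[OF that] by (rule integrable_mult_right)
    moreover have "AE \<omega> in M. - L * real_cond_exp M (F k) (X k) \<omega> = U k \<omega>"
      using ctrl[of k] by eventually_elim simp
    ultimately show ?thesis
      by (rule integrable_cong_AE_imp[OF _ U])
  qed
  show state: "integrable M (X k)" for k
  proof (induction k)
    case (Suc k)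
    then have "integrable M (\<lambda>\<omega>. a * X k \<omega> + b * U k \<omega> + W k \<omega>)"
      using input W by auto
    then show ?case
      by (subst Bochner_Integration.integrable_cong[OF refl dyn])
  qed (fact X0)
  show "integrable M (U k)"
    by (rule input[OF state])
qed

lemma (in prob_space) cond_exp_state:
  assumes sub: "subalgebra M F"
    and X: "\<And>k. integrable M (X k)"
    and U: "\<And>k. integrable M (U k)"
    and W: "\<And>k. integrable M (W k)"
    and UF: "\<And>j. j < m \<Longrightarrow> U (t + j) \<in> borel_measurable F"
    and dyn: "\<And>k \<omega>. \<omega> \<in> space M \<Longrightarrow> X (Suc k) \<omega> = a * X k \<omega> + b * U k \<omega> + W k \<omega>"
  shows "AE \<omega> in M. real_cond_exp M F (X (t + m)) \<omega> =
    a ^ m * real_cond_exp M F (X t) \<omega> + (\<Sum>j<m. a ^ (m - 1 - j) * b * U (t + j) \<omega>)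
    + real_cond_exp M F (accumulated_noise a W t m) \<omega>"
proof -
  interpret finite_measure_subalgebra M F
    using sub by unfold_locales
  let ?V = "\<lambda>\<omega>. \<Sum>j<m. a ^ (m - 1 - j) * b * U (t + j) \<omega>"
  have iX: "integrable M (\<lambda>\<omega>. a ^ m * X t \<omega>)"
    using X by simp
  have iV: "integrable M ?V"
    using U by auto
  have iS: "integrable M (accumulated_noise a W t m)"
    unfolding accumulated_noise_def[abs_def] using W by auto
  have V: "?V \<in> borel_measurable F"
    using UF by (auto intro!: borel_measurable_sum borel_measurable_times)
  have "AE \<omega> in M. real_cond_exp M F (X (t + m)) \<omega>
      = real_cond_exp M F (\<lambda>\<omega>. (a ^ m * X t \<omega> + ?V \<omega>) + accumulated_noise a W t m \<omega>) \<omega>"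
  proof (rule real_cond_exp_cong)
    show "AE \<omega> in M. X (t + m) \<omega> = a ^ m * X t \<omega> + ?V \<omega> + accumulated_noise a W t m \<omega>"
      by (rule AE_I2) (rule state_unrolled, rule dyn)
  qed (use X iX iV iS in auto)
  moreover have "AE \<omega> in M.
      real_cond_exp M F (\<lambda>\<omega>. (a ^ m * X t \<omega> + ?V \<omega>) + accumulated_noise a W t m \<omega>) \<omega>
      = real_cond_exp M F (\<lambda>\<omega>. a ^ m * X t \<omega> + ?V \<omega>) \<omega>
        + real_cond_exp M F (accumulated_noise a W t m) \<omega>"
    using iX iV iS by (intro real_cond_exp_add) auto
  moreover have "AE \<omega> in M. real_cond_exp M F (\<lambda>\<omega>. a ^ m * X t \<omega> + ?V \<omega>) \<omega>
      = real_cond_exp M F (\<lambda>\<omega>. a ^ m * X t \<omega>) \<omega> + real_cond_exp M F ?V \<omega>"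
    by (rule real_cond_exp_add[OF iX iV])
  moreover have "AE \<omega> in M. real_cond_exp M F (\<lambda>\<omega>. a ^ m * X t \<omega>) \<omega>
      = a ^ m * real_cond_exp M F (X t) \<omega>"
    by (rule real_cond_exp_cmult[OF X])
  moreover have "AE \<omega> in M. real_cond_exp M F ?V \<omega> = ?V \<omega>"
    by (rule real_cond_exp_F_meas[OF iV V])
  ultimately show ?thesis
    by eventually_elim simp
qed

theorem mainTheorem4:
  fixes M :: "'w measure"
    and a b q r P L \<sigma>\<^sub>W :: real
    and \<tau> :: nat
    and f :: "nat \<Rightarrow> sched_hist \<Rightarrow> nat"
    and W X U :: "nat \<Rightarrow> 'w \<Rightarrow> real"
    and D :: "nat \<Rightarrow> 'w \<Rightarrow> nat"
  assumes "prob_space M"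
    and delay: "\<tau> \<ge> 1"
    and weights: "q > 0" "r > 0"
    and riccati: "P = a\<^sup>2 * P + q - (a * b * P)\<^sup>2 / (r + b\<^sup>2 * P)"
    and gain: "L = a * b * P / (r + b\<^sup>2 * P)"
    and noise: "disturbance M W \<sigma>\<^sub>W"
    and initial: "integrable M (X 0)"
    and dynamics: "\<And>k \<omega>. \<omega> \<in> space M \<Longrightarrow> X (Suc k) \<omega> = a * X k \<omega> + b * U k \<omega> + W k \<omega>"
    and policy: "f \<in> admissible_policies"
    and scheduler: "\<And>k \<omega>. \<omega> \<in> space M \<Longrightarrow> D k \<omega> = f k (sched_history X D U k \<omega>)"
    and input: "\<And>k. U k \<in> borel_measurable M"
    and controller: "\<And>k. AE \<omega> in M. U k \<omega> = - L * real_cond_exp M (ctrl_info M \<tau> X D U k) (X k) \<omega>"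
    and symmetric: "symmetric_scheduling M a \<tau> W X D U"
  shows "\<forall>k. \<forall>m\<ge>\<tau>. AE \<omega> in M. relevant_update M \<tau> X D U k m \<omega> \<longrightarrow>
    (let t = last_update D k \<omega> in
       U (t + m) \<omega> = - L * real_cond_exp M (ctrl_info M \<tau> X D U (t + m)) (X (t + m)) \<omega> \<and>
       - L * real_cond_exp M (ctrl_info M \<tau> X D U (t + m)) (X (t + m)) \<omega> =
         - L * (a - b * L) ^ (m - \<tau>) *
           (a ^ \<tau> * X t \<omega> + (\<Sum>j<\<tau>. a ^ (\<tau> - 1 - j) * b * U (t + j) \<omega>)))"
proof (intro allI impI)
  fix k m :: nat
  assume m: "\<tau> \<le> m"
  interpret prob_space M by fact
  let ?F = "ctrl_info M \<tau> X D U"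
  let ?e = "\<lambda>t i \<omega>. a ^ i * X t \<omega> + (\<Sum>j<i. a ^ (i - 1 - j) * b * U (t + j) \<omega>)"
  have W: "integrable M (W i)" for i
    using noise by (simp add: disturbance_def)
  have X: "X i \<in> borel_measurable M" for i
  proof (induction i)
    case (Suc i)
    then have "(\<lambda>\<omega>. a * X i \<omega> + b * U i \<omega> + W i \<omega>) \<in> borel_measurable M"
      using input[of i] W[of i] by measurable
    then show ?case
      by (subst measurable_cong[OF dynamics])
  qed (use initial in auto)
  have D: "D i \<in> M \<rightarrow>\<^sub>M count_space {0, 1}" for i
    by (rule measurable_scheduler[OF X input policy scheduler])
  have sub: "subalgebra M (?F i)" for i
    by (rule subalgebra_ctrl_info[OF X input D])
  have int: "integrable M (X i)" "integrable M (U i)" for i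
    using closed_loop_integrable[of ?F X W a b U L] sub initial W dynamics input controller by auto
  have estimate: "AE \<omega> in M. relevant_update M \<tau> X D U k i \<omega> \<longrightarrow> last_update D k \<omega> = t \<longrightarrow>
      real_cond_exp M (?F (t + i)) (X (t + i)) \<omega> = ?e t i \<omega>" if "\<tau> \<le> i" for i t
  proof -
    have "U (t + j) \<in> borel_measurable (?F (t + i))" if "j < i" for j
      using that by (intro input_measurable_ctrl_info) simp
    then have "AE \<omega> in M. real_cond_exp M (?F (t + i)) (X (t + i)) \<omega> =
        a ^ i * real_cond_exp M (?F (t + i)) (X t) \<omega> + (\<Sum>j<i. a ^ (i - 1 - j) * b * U (t + j) \<omega>)
        + real_cond_exp M (?F (t + i)) (accumulated_noise a W t i) \<omega>"
      by (intro cond_exp_state sub int W dynamics)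
    moreover have "AE \<omega> in M.
        real_cond_exp M (?F (t + \<tau>)) (indicator {\<omega>'. D t \<omega>' = 1}) \<omega> = 1 \<longrightarrow>
        real_cond_exp M (?F (t + i)) (X t) \<omega> = X t \<omega>"
      using that by (intro known_update_estimate X input D int) auto
    moreover have "AE \<omega> in M. relevant_update M \<tau> X D U k i \<omega> \<longrightarrow>
        (let t = last_update D k \<omega> in
           real_cond_exp M (?F (t + i)) (accumulated_noise a W t i) \<omega> = 0)"
      using symmetric unfolding symmetric_scheduling_def by blast
    ultimately show ?thesis
      by eventually_elim (auto simp: relevant_update_def Let_def)
  qed
  have "AE \<omega> in M. \<forall>t i. \<tau> \<le> i \<longrightarrow> relevant_update M \<tau> X D U k i \<omega> \<longrightarrow>
      last_update D k \<omega> = t \<longrightarrow> real_cond_exp M (?F (t + i)) (X (t + i)) \<omega> = ?e t i \<omega>"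
    unfolding AE_all_countable using estimate by auto
  moreover have "AE \<omega> in M. \<forall>n. U n \<omega> = - L * real_cond_exp M (?F n) (X n) \<omega>"
    unfolding AE_all_countable using controller by blast
  ultimately show "AE \<omega> in M. relevant_update M \<tau> X D U k m \<omega> \<longrightarrow>
    (let t = last_update D k \<omega> in
       U (t + m) \<omega> = - L * real_cond_exp M (?F (t + m)) (X (t + m)) \<omega> \<and>
       - L * real_cond_exp M (?F (t + m)) (X (t + m)) \<omega> =
         - L * (a - b * L) ^ (m - \<tau>) *
           (a ^ \<tau> * X t \<omega> + (\<Sum>j<\<tau>. a ^ (\<tau> - 1 - j) * b * U (t + j) \<omega>)))"
  proof eventually_elim
    case (elim \<omega>)
    show ?case
    proof (rule impI)
      assume rel: "relevant_update M \<tau> X D U k m \<omega>"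
      define t where "t = last_update D k \<omega>"
      have est: "real_cond_exp M (?F (t + i)) (X (t + i)) \<omega> = ?e t i \<omega>" if "\<tau> \<le> i" "i \<le> m" for i
        using elim(1) relevant_update_earlier[OF rel] that by (auto simp: t_def)
      have "U (t + i) \<omega> = - L * ?e t i \<omega>" if "\<tau> \<le> i" "i < m" for i
        using elim(2) est[of i] that by auto
      then have "?e t m \<omega> = (a - b * L) ^ (m - \<tau>) * ?e t \<tau> \<omega>"
        using prediction_closed_loop[OF m, where u = "\<lambda>j. U (t + j) \<omega>"] by blast
      then show "let t = last_update D k \<omega> in
         U (t + m) \<omega> = - L * real_cond_exp M (?F (t + m)) (X (t + m)) \<omega> \<and>
         - L * real_cond_exp M (?F (t + m)) (X (t + m)) \<omega> =
           - L * (a - b * L) ^ (m - \<tau>) * ?e t \<tau> \<omega>"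
        unfolding Let_def t_def[symmetric] using elim(2) est[of m] m by simp
    qed
  qed
qed

end
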